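(* Suppose that $(S_j)_{j\in\mathbb{N}}$ is a sequence of mutually independent, symmetric real-valued random variables. If $\sum_{j=1}^\infty S_j$ diverges almost surely, then $$\limsup_{n\to\infty}\sum_{j=1}^n S_j=\infty\quad\text{and}\quad\liminf_{n\to\infty}\sum_{j=1}^n S_j=-\infty\quad\text{almost surely.}$$
   Context: A random variable $S$ is symmetric if $S$ and $-S$ have the same distribution. A series diverges if its partial sums do not converge to a finite real limit. *)

theory Defs
  imports "HOL-Probability.Probability"
begin

(* distr is only meaningful for measurable maps, hence the explicit measurability conjunct. *)
definition symmetric_rv :: "'a measure \<Rightarrow> ('a \<Rightarrow> real) \<Rightarrow> bool" where
  "symmetric_rv M X \<longleftrightarrow>
     X \<in> borel_measurable M \<and> distr M borel X = distr M borel (\<lambda>\<omega>. - X \<omega>)"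

end

theory Submission
  imports Defs
begin

text \<open>
  By Kolmogorov's 0-1 law the partial sums \<open>T\<^sub>n\<close> are unbounded above with probability 0 or 1. If the
  probability is 0, the upper tails of the \<open>T\<^sub>n\<close> are uniformly small, and by symmetry the sequence is
  tight. Then \<open>E cos (t T\<^sub>n)\<close>, a product over the summands, stays away from 0 for small \<open>t\<close>, which
  forces \<open>T\<^sub>n\<close> to be Cauchy in probability; Levy's maximal inequality upgrades this to almost sure
  convergence, contrary to the assumption. The lower limit follows by passing to \<open>- S\<^sub>j\<close>.
\<close>

section \<open>Symmetric random variables and their independent sums\<close>

lemma symmetric_rvD_measurable [measurable_dest]:
  "symmetric_rv M X \<Longrightarrow> X \<in> borel_measurable M"
  by (simp add: symmetric_rv_def)

lemma symmetric_rv_uminus: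
  assumes "symmetric_rv M X"
  shows "symmetric_rv M (\<lambda>\<omega>. - X \<omega>)"
  using assms by (auto simp: symmetric_rv_def)

lemma symmetric_rv_measure:
  assumes X: "symmetric_rv M X" and A: "A \<in> sets borel"
  shows "measure M {\<omega> \<in> space M. X \<omega> \<in> A} = measure M {\<omega> \<in> space M. - X \<omega> \<in> A}"
proof -
  have [measurable]: "X \<in> borel_measurable M" by (rule symmetric_rvD_measurable[OF X])
  have "measure (distr M borel X) A = measure (distr M borel (\<lambda>\<omega>. - X \<omega>)) A"
    using X by (simp add: symmetric_rv_def)
  then show ?thesis
    using A by (simp add: measure_distr vimage_def Int_def conj_commute)
qed

lemma symmetric_rv_integral:
  fixes f :: "real \<Rightarrow> real"
  assumes X: "symmetric_rv M X" and f: "f \<in> borel_measurable borel"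
  shows "(\<integral>\<omega>. f (X \<omega>) \<partial>M) = (\<integral>\<omega>. f (- X \<omega>) \<partial>M)"
proof -
  have [measurable]: "X \<in> borel_measurable M" by (rule symmetric_rvD_measurable[OF X])
  have "(\<integral>x. f x \<partial>distr M borel X) = (\<integral>x. f x \<partial>distr M borel (\<lambda>\<omega>. - X \<omega>))"
    using X by (simp add: symmetric_rv_def)
  then show ?thesis
    using f by (simp add: integral_distr)
qed

context prob_space
begin

text \<open>Independence makes the law of the sum the convolution of the two laws, and negating both
  variables changes neither law.\<close>

lemma symmetric_rv_add:
  assumes ind: "indep_var borel X borel Y" and X: "symmetric_rv M X" and Y: "symmetric_rv M Y"
  shows "symmetric_rv M (\<lambda>\<omega>. X \<omega> + Y \<omega>)"
proof -
  have [measurable]: "X \<in> borel_measurable M" "Y \<in> borel_measurable M"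
    using X Y by (auto simp: symmetric_rv_def)
  have ind': "indep_var borel (\<lambda>\<omega>. - X \<omega>) borel (\<lambda>\<omega>. - Y \<omega>)"
    using indep_var_compose[OF ind, of uminus borel uminus borel] by (simp add: comp_def)
  have "distr M borel (\<lambda>\<omega>. X \<omega> + Y \<omega>) = convolution (distr M borel X) (distr M borel Y)"
    by (rule sum_indep_random_variable[OF ind]) measurable
  also have "\<dots> = convolution (distr M borel (\<lambda>\<omega>. - X \<omega>)) (distr M borel (\<lambda>\<omega>. - Y \<omega>))"
    using X Y by (simp add: symmetric_rv_def)
  also have "\<dots> = distr M borel (\<lambda>\<omega>. - X \<omega> + - Y \<omega>)"
    by (rule sum_indep_random_variable[OF ind', symmetric]) measurable
  finally show ?thesis by (simp add: symmetric_rv_def)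
qed

lemma symmetric_rv_sum:
  fixes X :: "'i \<Rightarrow> 'a \<Rightarrow> real"
  assumes "finite I" "indep_vars (\<lambda>_. borel) X I" "\<And>i. i \<in> I \<Longrightarrow> symmetric_rv M (X i)"
  shows "symmetric_rv M (\<lambda>\<omega>. \<Sum>i\<in>I. X i \<omega>)"
  using assms
proof (induction I rule: finite_induct)
  case empty
  then show ?case by (simp add: symmetric_rv_def)
next
  case (insert i I)
  have "indep_vars (\<lambda>_. borel) X I"
    using insert.prems(1) by (rule indep_vars_subset) auto
  with insert show ?case
    by (simp add: symmetric_rv_add[OF indep_vars_sum])
qed

text \<open>The events \<open>0 \<le> X\<close> and \<open>0 \<le> - X\<close> cover the space and
  are equally likely. They overlap where \<open>X\<close> vanishes, hence only an
  inequality.\<close>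

lemma symmetric_rv_nonneg_ge_half:
  assumes X: "symmetric_rv M X"
  shows "prob {\<omega> \<in> space M. 0 \<le> X \<omega>} \<ge> 1 / 2"
proof -
  have [measurable]: "X \<in> borel_measurable M" by (rule symmetric_rvD_measurable[OF X])
  have "1 = prob ({\<omega> \<in> space M. 0 \<le> X \<omega>} \<union> {\<omega> \<in> space M. 0 \<le> - X \<omega>})"
    by (subst prob_space[symmetric], rule arg_cong[where f = prob]) auto
  also have "\<dots> \<le> prob {\<omega> \<in> space M. 0 \<le> X \<omega>} + prob {\<omega> \<in> space M. 0 \<le> - X \<omega>}"
    by (rule measure_Un_le) auto
  also have "prob {\<omega> \<in> space M. 0 \<le> - X \<omega>} = prob {\<omega> \<in> space M. 0 \<le> X \<omega>}"
    using symmetric_rv_measure[OF X, of "{0..}"] by simp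
  finally show ?thesis by simp
qed

section \<open>Independence of disjoint blocks and Levy's maximal inequality\<close>

text \<open>Here \<open>f\<close> and \<open>g\<close> may read an entire block of variables, as is
  needed for a first-passage event, which involves all partial sums up to an index.\<close>

lemma indep_var_disjoint_maps:
  fixes X :: "'i \<Rightarrow> 'a \<Rightarrow> real"
  assumes ind: "indep_vars (\<lambda>_. borel) X K"
    and IJ: "I \<inter> J = {}" "I \<subseteq> K" "J \<subseteq> K"
    and f: "f \<in> measurable (PiM I (\<lambda>_. borel)) N" and g: "g \<in> measurable (PiM J (\<lambda>_. borel)) N'"
  shows "indep_var N (\<lambda>\<omega>. f (restrict (\<lambda>i. X i \<omega>) I)) N' (\<lambda>\<omega>. g (restrict (\<lambda>i. X i \<omega>) J))"
  using indep_var_compose[OF indep_var_restrict[OF ind IJ] f g] by (simp add: comp_def)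

lemma indep_var_disjoint_sums:
  fixes X :: "'i \<Rightarrow> 'a \<Rightarrow> real"
  assumes ind: "indep_vars (\<lambda>_. borel) X K" and IJ: "I \<inter> J = {}" "I \<subseteq> K" "J \<subseteq> K"
  shows "indep_var borel (\<lambda>\<omega>. \<Sum>i\<in>I. X i \<omega>) borel (\<lambda>\<omega>. \<Sum>i\<in>J. X i \<omega>)"
  using indep_var_disjoint_maps[OF ind IJ, of "\<lambda>f. \<Sum>i\<in>I. f i" borel "\<lambda>f. \<Sum>i\<in>J. f i" borel]
  by simp

text \<open>Reflection: after the first passage above \<open>a\<close>, the independent symmetric remainder is
  nonnegative with probability at least \<open>1/2\<close>.\<close>

lemma Levy_maximal_inequality:
  fixes X :: "nat \<Rightarrow> 'a \<Rightarrow> real"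
  assumes ind: "indep_vars (\<lambda>_. borel) X {m..<n}"
    and sym: "\<And>i. i \<in> {m..<n} \<Longrightarrow> symmetric_rv M (X i)"
  shows "prob {\<omega> \<in> space M. \<exists>k\<in>{m..n}. a < (\<Sum>i=m..<k. X i \<omega>)}
           \<le> 2 * prob {\<omega> \<in> space M. a < (\<Sum>i=m..<n. X i \<omega>)}"
proof -
  \<comment> \<open>\<open>A k\<close> says that \<open>k\<close> is the first index at which the
    partial sum exceeds \<open>a\<close>; \<open>B k\<close> says that the remaining increment is
    nonnegative. The \<open>A k\<close> are disjoint, and \<open>A k \<inter> B k\<close> forces the
    final sum above \<open>a\<close>.\<close>
  define A where "A k = {\<omega> \<in> space M. a < (\<Sum>i=m..<k. X i \<omega>) \<and> (\<forall>j\<in>{m..<k}. (\<Sum>i=m..<j. X i \<omega>) \<le> a)}" for k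
  define B where "B k = {\<omega> \<in> space M. 0 \<le> (\<Sum>i=k..<n. X i \<omega>)}" for k
  have X: "X i \<in> borel_measurable M" if "i \<in> {m..<n}" for i
    using sym[OF that] by (rule symmetric_rvD_measurable)
  have Sm [measurable]: "(\<lambda>\<omega>. \<Sum>i=j..<k. X i \<omega>) \<in> borel_measurable M" if "m \<le> j" "k \<le> n" for j k
    using that by (intro borel_measurable_sum X) auto
  have A_meas: "A k \<in> events" if "k \<in> {m..n}" for k
  proof -
    have "(\<lambda>\<omega>. \<Sum>i=m..<j. X i \<omega>) \<in> borel_measurable M" if "j \<le> k" for j
      using that \<open>k \<in> {m..n}\<close> by (intro Sm) auto
    then show ?thesis unfolding A_def
      by (intro sets.sets_Collect_conj sets.sets_Collect_finite_All borel_measurable_le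
            borel_measurable_less) auto
  qed
  have B_meas: "B k \<in> events" if "k \<in> {m..n}" for k
    unfolding B_def using Sm[of k n] that by (intro borel_measurable_le) auto
  have AB: "prob (A k) \<le> 2 * prob (A k \<inter> B k)" if k: "k \<in> {m..n}" for k
  proof -
    define P where "P f \<longleftrightarrow> a < (\<Sum>i=m..<k. f i) \<and> (\<forall>j\<in>{m..<k}. (\<Sum>i=m..<j. f i) \<le> a)"
      for f :: "nat \<Rightarrow> real"
    have sum_m: "(\<lambda>f. \<Sum>i=m..<j. f i) \<in> borel_measurable (PiM {m..<k} (\<lambda>_. borel :: real measure))"
      if "j \<le> k" for j
      using that by (intro borel_measurable_sum measurable_component_singleton) auto
    have P_meas: "Measurable.pred (PiM {m..<k} (\<lambda>_. borel)) P"
      unfolding P_def pred_def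
      by (intro sets.sets_Collect_conj sets.sets_Collect_finite_All borel_measurable_le
            borel_measurable_less sum_m) auto
    \<comment> \<open>\<open>indep_var\<close> takes two variables with values in the same type, so
      the first-passage condition is coded as a real 0-1 function and recovered as the event
      \<open>g = 1\<close>.\<close>
    define g :: "(nat \<Rightarrow> real) \<Rightarrow> real" where "g f = (if P f then 1 else 0)" for f
    have g_meas: "g \<in> borel_measurable (PiM {m..<k} (\<lambda>_. borel))"
      unfolding g_def using P_meas by measurable
    have "indep_var borel (\<lambda>\<omega>. g (restrict (\<lambda>i. X i \<omega>) {m..<k}))
        borel (\<lambda>\<omega>. \<Sum>i=k..<n. restrict (\<lambda>i. X i \<omega>) {k..<n} i)"
      using k by (intro indep_var_disjoint_maps[OF ind _ _ _ g_meas]) auto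
    from indep_varD[OF this, of "{1}" "{0..}"]
    have "prob ((\<lambda>\<omega>. (g (restrict (\<lambda>i. X i \<omega>) {m..<k}), \<Sum>i=k..<n. X i \<omega>)) -` ({1} \<times> {0..}) \<inter> space M)
      = prob ((\<lambda>\<omega>. g (restrict (\<lambda>i. X i \<omega>) {m..<k})) -` {1} \<inter> space M)
      * prob ((\<lambda>\<omega>. \<Sum>i=k..<n. X i \<omega>) -` {0..} \<inter> space M)"
      by simp
    moreover have "g f = 1 \<longleftrightarrow> P f" for f by (simp add: g_def)
    moreover have "P (restrict (\<lambda>i. X i \<omega>) {m..<k}) \<longleftrightarrow>
       a < (\<Sum>i=m..<k. X i \<omega>) \<and> (\<forall>j\<in>{m..<k}. (\<Sum>i=m..<j. X i \<omega>) \<le> a)" for \<omega>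
    proof -
      have "(\<Sum>i=m..<j. restrict (\<lambda>i. X i \<omega>) {m..<k} i) = (\<Sum>i=m..<j. X i \<omega>)" if "j \<le> k" for j
        using that by (intro sum.cong) auto
      then show ?thesis by (simp add: P_def)
    qed
    ultimately have "prob (A k \<inter> B k) = prob (A k) * prob (B k)"
      unfolding A_def B_def
      by (simp add: vimage_def Int_def conj_ac)
    moreover have "prob (B k) \<ge> 1 / 2"
      unfolding B_def using k
      by (intro symmetric_rv_nonneg_ge_half symmetric_rv_sum sym indep_vars_subset[OF ind]) auto
    ultimately show ?thesis
      using mult_left_mono[of "1/2" "prob (B k)" "prob (A k)"] by simp
  qed
  have disj: "disjoint_family_on A {m..n}"
    unfolding disjoint_family_on_def
  proof (intro ballI impI)
    fix k l assume "k \<in> {m..n}" "l \<in> {m..n}" "k \<noteq> l"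
    then show "A k \<inter> A l = {}"
      by (cases k l rule: linorder_cases) (force simp: A_def)+
  qed
  have "prob {\<omega> \<in> space M. \<exists>k\<in>{m..n}. a < (\<Sum>i=m..<k. X i \<omega>)} \<le> prob (\<Union>k\<in>{m..n}. A k)"
  proof (rule finite_measure_mono)
    show "{\<omega> \<in> space M. \<exists>k\<in>{m..n}. a < (\<Sum>i=m..<k. X i \<omega>)} \<subseteq> (\<Union>k\<in>{m..n}. A k)"
    proof safe
      fix \<omega> k assume \<omega>: "\<omega> \<in> space M" and k: "k \<in> {m..n}" "a < (\<Sum>i=m..<k. X i \<omega>)"
      \<comment> \<open>The least index of passage is the one whose event \<open>A k\<close>
        contains the outcome.\<close>
      define Q where "Q k \<longleftrightarrow> k \<in> {m..n} \<and> a < (\<Sum>i=m..<k. X i \<omega>)" for k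
      have "Q k" using k by (simp add: Q_def)
      then have "Q (LEAST k. Q k)" "\<And>j. j < (LEAST k. Q k) \<Longrightarrow> \<not> Q j"
        by (auto intro: LeastI dest: not_less_Least)
      with \<omega> show "\<omega> \<in> (\<Union>k\<in>{m..n}. A k)"
        by (intro UN_I[of "LEAST k. Q k"]) (auto simp: Q_def A_def not_less)
    qed
    show "(\<Union>k\<in>{m..n}. A k) \<in> events" using A_meas by auto
  qed
  also have "\<dots> = (\<Sum>k\<in>{m..n}. prob (A k))"
    using A_meas disj by (intro finite_measure_finite_Union) auto
  also have "\<dots> \<le> (\<Sum>k\<in>{m..n}. 2 * prob (A k \<inter> B k))"
    by (intro sum_mono AB)
  also have "\<dots> = 2 * (\<Sum>k\<in>{m..n}. prob (A k \<inter> B k))"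
    by (simp add: sum_distrib_left)
  also have "(\<Sum>k\<in>{m..n}. prob (A k \<inter> B k)) = prob (\<Union>k\<in>{m..n}. A k \<inter> B k)"
  proof (rule finite_measure_finite_Union[symmetric])
    show "disjoint_family_on (\<lambda>k. A k \<inter> B k) {m..n}"
      using disj unfolding disjoint_family_on_def by blast
  qed (use A_meas B_meas in auto)
  also have "\<dots> \<le> prob {\<omega> \<in> space M. a < (\<Sum>i=m..<n. X i \<omega>)}"
  proof (rule finite_measure_mono)
    show "(\<Union>k\<in>{m..n}. A k \<inter> B k) \<subseteq> {\<omega> \<in> space M. a < (\<Sum>i=m..<n. X i \<omega>)}"
    proof safe
      fix \<omega> k assume k: "k \<in> {m..n}" and \<omega>: "\<omega> \<in> A k" "\<omega> \<in> B k"
      have "(\<Sum>i=m..<n. X i \<omega>) = (\<Sum>i=m..<k. X i \<omega>) + (\<Sum>i=k..<n. X i \<omega>)"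
        using k by (simp add: sum.atLeastLessThan_concat)
      with \<omega> show "a < (\<Sum>i=m..<n. X i \<omega>)" by (simp add: A_def B_def)
    qed (auto simp: A_def)
    show "{\<omega> \<in> space M. a < (\<Sum>i=m..<n. X i \<omega>)} \<in> events"
      using Sm[of m n] by (intro borel_measurable_less) auto
  qed
  finally show ?thesis by simp
qed

section \<open>From tightness to the Cauchy property in probability\<close>

text \<open>A real form of the multiplicativity of characteristic functions: in the addition formula
  the sine term factors by independence, and \<open>E sin (t Y)\<close> is 0 because sine is odd and
  \<open>Y\<close> symmetric.\<close>

lemma expectation_cos_add_symmetric:
  assumes ind: "indep_var borel X borel Y" and Y: "symmetric_rv M Y"
  shows "expectation (\<lambda>\<omega>. cos (t * (X \<omega> + Y \<omega>)))
       = expectation (\<lambda>\<omega>. cos (t * X \<omega>)) * expectation (\<lambda>\<omega>. cos (t * Y \<omega>))"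
proof -
  have [measurable]: "X \<in> borel_measurable M" "Y \<in> borel_measurable M"
    using ind by (auto dest: indep_var_rv1 indep_var_rv2)
  have int: "integrable M (\<lambda>\<omega>. cos (t * Z \<omega>))" "integrable M (\<lambda>\<omega>. sin (t * Z \<omega>))"
    if [measurable]: "Z \<in> borel_measurable M" for Z
    by (auto intro!: integrable_const_bound[where B = 1])
  have c: "indep_var borel (\<lambda>\<omega>. cos (t * X \<omega>)) borel (\<lambda>\<omega>. cos (t * Y \<omega>))"
    using indep_var_compose[OF ind, of "\<lambda>x. cos (t * x)" borel "\<lambda>x. cos (t * x)" borel]
    by (simp add: comp_def)
  have s: "indep_var borel (\<lambda>\<omega>. sin (t * X \<omega>)) borel (\<lambda>\<omega>. sin (t * Y \<omega>))"
    using indep_var_compose[OF ind, of "\<lambda>x. sin (t * x)" borel "\<lambda>x. sin (t * x)" borel]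
    by (simp add: comp_def)
  have "expectation (\<lambda>\<omega>. sin (t * Y \<omega>)) = 0"
    using symmetric_rv_integral[OF Y, of "\<lambda>x. sin (t * x)"] by simp
  moreover have "expectation (\<lambda>\<omega>. cos (t * (X \<omega> + Y \<omega>))) =
      expectation (\<lambda>\<omega>. cos (t * X \<omega>) * cos (t * Y \<omega>)) - expectation (\<lambda>\<omega>. sin (t * X \<omega>) * sin (t * Y \<omega>))"
    by (subst Bochner_Integration.integral_diff[symmetric])
       (auto simp: distrib_left cos_add intro!: indep_var_integrable c s int)
  ultimately show ?thesis
    by (simp add: indep_var_lebesgue_integral[OF c] indep_var_lebesgue_integral[OF s] int)
qed

lemma sum_lessThan_split:
  fixes f :: "nat \<Rightarrow> 'b :: comm_monoid_add"
  assumes "m \<le> n"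
  shows "(\<Sum>i<n. f i) = (\<Sum>i<m. f i) + (\<Sum>i=m..<n. f i)"
  using assms by (simp add: lessThan_atLeast0 sum.atLeastLessThan_concat)

lemma indep_vars_sequence_measurable:
  "indep_vars (\<lambda>_. borel) X UNIV \<Longrightarrow> X i \<in> borel_measurable M"
  by (simp add: indep_vars_def)

text \<open>For small \<open>t\<close> the numbers \<open>E cos (t T\<^sub>n)\<close> are bounded away from \<open>0\<close> by tightness and decrease
  in \<open>n\<close>, so \<open>E cos (t (T\<^sub>n - T\<^sub>m))\<close>, a ratio of two of them, tends to \<open>1\<close>.\<close>

lemma Cauchy_in_probability_of_tight:
  fixes X :: "nat \<Rightarrow> 'a \<Rightarrow> real"
  assumes ind: "indep_vars (\<lambda>_. borel) X UNIV"
    and sym: "\<And>i. symmetric_rv M (X i)"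
    and tight: "\<And>e. e > 0 \<Longrightarrow> \<exists>A. \<forall>n. prob {\<omega> \<in> space M. A < (\<Sum>i<n. X i \<omega>)} \<le> e"
    and \<epsilon>: "\<epsilon> > 0" and \<eta>: "\<eta> > 0"
  shows "\<exists>m. \<forall>n\<ge>m. prob {\<omega> \<in> space M. \<epsilon> < \<bar>\<Sum>i=m..<n. X i \<omega>\<bar>} \<le> \<eta>"
proof -
  define T where "T n \<omega> = (\<Sum>i<n. X i \<omega>)" for n \<omega>
  define D where "D m n \<omega> = (\<Sum>i=m..<n. X i \<omega>)" for m n \<omega>
  note [measurable] = indep_vars_sequence_measurable[OF ind]
  have [measurable]: "T n \<in> borel_measurable M" "D m n \<in> borel_measurable M" for m n
    unfolding T_def D_def by measurable
  have D_sym: "symmetric_rv M (D m n)" for m n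
    unfolding D_def by (intro symmetric_rv_sum sym indep_vars_subset[OF ind]) auto
  have T_sym: "symmetric_rv M (T n)" for n
    unfolding T_def by (intro symmetric_rv_sum sym indep_vars_subset[OF ind]) auto
  have TD: "T n \<omega> = T m \<omega> + D m n \<omega>" if "m \<le> n" for m n \<omega>
    unfolding T_def D_def using that by (rule sum_lessThan_split)
  \<comment> \<open>The two-sided tails will be at most \<open>2 * e\<close>. The bound
    \<open>1 / 16\<close> then gives \<open>\<phi> n \<ge> 1 / 2 - 4 * e \<ge> 1 / 4\<close>, and
    \<open>\<eta> / 8\<close> makes two such tails cost at most \<open>\<eta> / 2\<close> at the
    end.\<close>
  define e where "e = min (\<eta> / 8) (1 / 16)"
  have e: "e > 0" "e \<le> \<eta> / 8" "e \<le> 1 / 16" using \<eta> by (auto simp: e_def)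
  obtain A0 where A0: "\<And>n. prob {\<omega> \<in> space M. A0 < T n \<omega>} \<le> e"
    using tight[OF e(1)] by (auto simp: T_def)
  define A where "A = max A0 1"
  have A: "A \<ge> 1" by (simp add: A_def)
  have tail: "prob {\<omega> \<in> space M. A < \<bar>T n \<omega>\<bar>} \<le> 2 * e" for n
  proof -
    have "prob {\<omega> \<in> space M. A < T n \<omega>} \<le> prob {\<omega> \<in> space M. A0 < T n \<omega>}"
      by (rule finite_measure_mono) (auto simp: A_def)
    moreover have "prob {\<omega> \<in> space M. A < - T n \<omega>} = prob {\<omega> \<in> space M. A < T n \<omega>}"
      using symmetric_rv_measure[OF T_sym, of "{A<..}" n] by simp
    moreover have "prob {\<omega> \<in> space M. A < \<bar>T n \<omega>\<bar>}
        \<le> prob ({\<omega> \<in> space M. A < T n \<omega>} \<union> {\<omega> \<in> space M. A < - T n \<omega>})"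
      by (rule finite_measure_mono) (auto simp: abs_if)
    moreover have "\<dots> \<le> prob {\<omega> \<in> space M. A < T n \<omega>} + prob {\<omega> \<in> space M. A < - T n \<omega>}"
      by (rule measure_Un_le) auto
    ultimately show ?thesis using A0[of n] by linarith
  qed
  \<comment> \<open>With this \<open>t\<close>, the bound
    \<open>\<bar>T n \<omega>\<bar> \<le> A\<close> puts the angle \<open>t * T n \<omega>\<close>
    within 1/2 of 0, below \<open>pi / 3\<close>, so its cosine is at least 1/2. A difference of two
    such sums has angle at most 1.\<close>
  define t where "t = 1 / (2 * A)"
  have t: "t > 0" "t * A = 1 / 2" using A by (auto simp: t_def)
  define \<phi> where "\<phi> n = expectation (\<lambda>\<omega>. cos (t * T n \<omega>))" for n
  define \<psi> where "\<psi> m n = expectation (\<lambda>\<omega>. cos (t * D m n \<omega>))" for m n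
  have int_cos: "integrable M (\<lambda>\<omega>. cos (t * Z \<omega>))" if [measurable]: "Z \<in> borel_measurable M" for Z
    by (auto intro!: integrable_const_bound[where B = 1])
  have int_ind: "integrable M (\<lambda>\<omega>. indicator B \<omega> :: real)" if "B \<in> events" for B
    using that by (intro integrable_real_indicator) (auto simp: emeasure_eq_measure)
  have \<phi>\<psi>: "\<phi> n = \<phi> m * \<psi> m n" if "m \<le> n" for m n
  proof -
    have "indep_var borel (T m) borel (D m n)"
      using indep_var_disjoint_sums[OF ind, of "{..<m}" "{m..<n}"]
      by (simp add: T_def[abs_def] D_def[abs_def] disjoint_iff)
    from expectation_cos_add_symmetric[OF this D_sym, of t] show ?thesis
      using TD[OF that] by (simp add: \<phi>_def \<psi>_def)
  qed
  have \<phi>_ge: "\<phi> n \<ge> 1 / 4" for n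
  proof -
    let ?B = "{\<omega> \<in> space M. A < \<bar>T n \<omega>\<bar>}"
    \<comment> \<open>On the tail event the left side is -3/2, below every cosine; off it the angle
      is below \<open>pi / 3\<close>.\<close>
    have "1 / 2 - 2 * indicator ?B \<omega> \<le> cos (t * T n \<omega>)" if "\<omega> \<in> space M" for \<omega>
    proof (cases "\<omega> \<in> ?B")
      case True
      then show ?thesis using cos_ge_minus_one[of "t * T n \<omega>"] by (simp del: cos_ge_minus_one)
    next
      case False
      with that have "\<bar>t * T n \<omega>\<bar> \<le> 1 / 2"
        using mult_left_mono[of "\<bar>T n \<omega>\<bar>" A t] t by (simp add: abs_mult)
      then have "cos (pi / 3) \<le> cos \<bar>t * T n \<omega>\<bar>"
        using pi_gt3 by (intro cos_monotone_0_pi_le) auto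
      then show ?thesis using False by (simp add: cos_60)
    qed
    then have "expectation (\<lambda>\<omega>. 1 / 2 - 2 * indicator ?B \<omega>) \<le> \<phi> n"
      unfolding \<phi>_def by (intro integral_mono int_cos Bochner_Integration.integrable_diff
          integrable_mult_right int_ind) auto
    also have "expectation (\<lambda>\<omega>. 1 / 2 - 2 * indicator ?B \<omega>) = 1 / 2 - 2 * prob ?B"
      by (subst Bochner_Integration.integral_diff) (auto intro!: int_ind integrable_mult_right simp: prob_space)
    finally show ?thesis using tail[of n] e by simp
  qed
  have \<psi>_le: "\<psi> m n \<le> 1" for m n
  proof -
    have "\<psi> m n \<le> expectation (\<lambda>\<omega>. 1)"
      unfolding \<psi>_def by (intro integral_mono int_cos) auto
    then show ?thesis by (simp add: prob_space)
  qed
  have "decseq \<phi>"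
  proof (rule decseq_SucI)
    fix n show "\<phi> (Suc n) \<le> \<phi> n"
      using \<phi>\<psi>[of n "Suc n"] mult_left_mono[OF \<psi>_le[of n "Suc n"], of "\<phi> n"] \<phi>_ge[of n] by simp
  qed
  then obtain L where L: "\<phi> \<longlonglongrightarrow> L"
    using decseq_convergent[of \<phi> "1 / 4"] \<phi>_ge by blast
  \<comment> \<open>The cap 1 keeps \<open>d\<close> where cosine is strictly decreasing.
    \<open>\<kappa>\<close> is then a lower bound for \<open>1 - cos (t * D m n \<omega>)\<close>
    whenever the angle lies between \<open>d\<close> and 1 in absolute value.\<close>
  define d where "d = min (t * \<epsilon>) 1"
  have d: "0 < d" "d \<le> 1" "d \<le> t * \<epsilon>" using t \<epsilon> by (auto simp: d_def)
  define \<kappa> where "\<kappa> = 1 - cos d"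
  have "cos d < cos 0" using d pi_gt3 by (intro cos_monotone_0_pi) auto
  then have \<kappa>: "\<kappa> > 0" by (simp add: \<kappa>_def)
  \<comment> \<open>The tolerance is chosen so that dividing by \<open>\<phi> m \<ge> 1 / 4\<close>
    and then by \<open>\<kappa>\<close> leaves \<open>\<eta> / 2\<close>.\<close>
  obtain m where m: "\<And>k n. k \<ge> m \<Longrightarrow> n \<ge> m \<Longrightarrow> dist (\<phi> k) (\<phi> n) < \<kappa> * \<eta> / 8"
    using LIMSEQ_imp_Cauchy[OF L] \<kappa> \<eta> unfolding Cauchy_def
    by (metis divide_pos_pos mult_pos_pos zero_less_numeral)
  show ?thesis
  proof (intro exI[of _ m] allI impI)
    fix n assume n: "m \<le> n"
    let ?B = "\<lambda>k. {\<omega> \<in> space M. A < \<bar>T k \<omega>\<bar>}" and ?E = "{\<omega> \<in> space M. \<epsilon> < \<bar>D m n \<omega>\<bar>}"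
    have "(1 - \<psi> m n) / 4 \<le> \<phi> m * (1 - \<psi> m n)"
      using mult_right_mono[OF \<phi>_ge[of m], of "1 - \<psi> m n"] \<psi>_le[of m n] by simp
    also have "\<dots> = \<phi> m - \<phi> n" using \<phi>\<psi>[OF n] by (simp add: algebra_simps)
    also have "\<dots> \<le> \<kappa> * \<eta> / 8" using m[of m n] n unfolding dist_real_def by linarith
    finally have \<psi>_ge: "(1 - \<psi> m n) / \<kappa> \<le> \<eta> / 2" using \<kappa> by (simp add: field_simps)
    \<comment> \<open>A Markov-type bound for \<open>1 - cos\<close>. Since cosine is periodic, a
      large increment could also give a value near 0; the two tail events absorb that case, and
      outside them the angle is at most 1.\<close>
    have "indicator ?E \<omega> \<le> indicator (?B n) \<omega> + indicator (?B m) \<omega> + (1 - cos (t * D m n \<omega>)) / \<kappa>"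
      if \<omega>: "\<omega> \<in> space M" for \<omega>
    proof (cases "\<omega> \<in> ?E \<and> \<omega> \<notin> ?B n \<and> \<omega> \<notin> ?B m")
      case True
      with \<omega> TD[OF n, of \<omega>] have D: "\<epsilon> < \<bar>D m n \<omega>\<bar>" "\<bar>D m n \<omega>\<bar> \<le> 2 * A" by auto
      have "d \<le> \<bar>t * D m n \<omega>\<bar>" "\<bar>t * D m n \<omega>\<bar> \<le> 1"
        using mult_left_mono[of \<epsilon> "\<bar>D m n \<omega>\<bar>" t] mult_left_mono[OF D(2), of t] D(1) t d
        unfolding abs_mult by linarith+
      then have "cos \<bar>t * D m n \<omega>\<bar> \<le> cos d"
        using d pi_gt3 by (intro cos_monotone_0_pi_le) auto
      then have "1 \<le> (1 - cos (t * D m n \<omega>)) / \<kappa>" using \<kappa> by (simp add: \<kappa>_def)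
      then show ?thesis using True by simp
    next
      case False
      have "0 \<le> (1 - cos (t * D m n \<omega>)) / \<kappa>" using \<kappa> by simp
      then show ?thesis using False by (auto simp: indicator_def)
    qed
    then have "expectation (indicator ?E)
        \<le> expectation (\<lambda>\<omega>. indicator (?B n) \<omega> + indicator (?B m) \<omega> + (1 - cos (t * D m n \<omega>)) / \<kappa>)"
      by (intro integral_mono Bochner_Integration.integrable_add int_ind
          integrable_divide Bochner_Integration.integrable_diff int_cos) auto
    also have "\<dots> = prob (?B n) + prob (?B m) + (1 - \<psi> m n) / \<kappa>"
      unfolding \<psi>_def
      by (simp add: int_ind int_cos prob_space Bochner_Integration.integrable_diff)
    finally have "prob ?E \<le> prob (?B n) + prob (?B m) + (1 - \<psi> m n) / \<kappa>" by simp
    also have "\<dots> \<le> \<eta>" using tail[of n] tail[of m] \<psi>_ge e by linarith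
    finally show "prob {\<omega> \<in> space M. \<epsilon> < \<bar>\<Sum>i=m..<n. X i \<omega>\<bar>} \<le> \<eta>" by (simp add: D_def)
  qed
qed

section \<open>Almost sure convergence of tight symmetric sums\<close>

text \<open>The Cauchy property in probability controls each increment \<open>D m n\<close>
  separately; the maximal inequality controls all increments from \<open>m\<close> at once, which
  yields the pathwise Cauchy property.\<close>

lemma AE_convergent_of_tight:
  fixes X :: "nat \<Rightarrow> 'a \<Rightarrow> real"
  assumes ind: "indep_vars (\<lambda>_. borel) X UNIV"
    and sym: "\<And>i. symmetric_rv M (X i)"
    and tight: "\<And>e. e > 0 \<Longrightarrow> \<exists>A. \<forall>n. prob {\<omega> \<in> space M. A < (\<Sum>i<n. X i \<omega>)} \<le> e"
  shows "AE \<omega> in M. convergent (\<lambda>n. \<Sum>i<n. X i \<omega>)"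
proof -
  define D where "D m n \<omega> = (\<Sum>i=m..<n. X i \<omega>)" for m n \<omega>
  note [measurable] = indep_vars_sequence_measurable[OF ind]
  have [measurable]: "D m n \<in> borel_measurable M" for m n
    unfolding D_def by measurable
  have ind': "indep_vars (\<lambda>_. borel) (\<lambda>i \<omega>. - X i \<omega>) UNIV"
    by (rule indep_vars_compose2[OF ind]) measurable
  \<comment> \<open>The factor 4 comes from two one-sided maximal inequalities, for \<open>X\<close>
    and \<open>- X\<close>, each with factor 2.\<close>
  have max: "prob {\<omega> \<in> space M. \<exists>k\<in>{m..n}. \<epsilon> < \<bar>D m k \<omega>\<bar>} \<le> 4 * prob {\<omega> \<in> space M. \<epsilon> < \<bar>D m n \<omega>\<bar>}"
    for m n \<epsilon>
  proof -
    let ?P = "{\<omega> \<in> space M. \<exists>k\<in>{m..n}. \<epsilon> < D m k \<omega>}" and ?N = "{\<omega> \<in> space M. \<exists>k\<in>{m..n}. \<epsilon> < - D m k \<omega>}"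
    have "prob {\<omega> \<in> space M. \<exists>k\<in>{m..n}. \<epsilon> < \<bar>D m k \<omega>\<bar>} \<le> prob (?P \<union> ?N)"
      by (rule finite_measure_mono) (auto simp: abs_if split: if_splits)
    also have "\<dots> \<le> prob ?P + prob ?N" by (rule measure_Un_le) auto
    also have "prob ?P \<le> 2 * prob {\<omega> \<in> space M. \<epsilon> < D m n \<omega>}"
      unfolding D_def by (intro Levy_maximal_inequality indep_vars_subset[OF ind] sym) auto
    also have "prob ?N \<le> 2 * prob {\<omega> \<in> space M. \<epsilon> < - D m n \<omega>}"
      using Levy_maximal_inequality[OF indep_vars_subset[OF ind'] symmetric_rv_uminus[OF sym], of m n \<epsilon>]
      by (simp add: D_def sum_negf)
    also have "prob {\<omega> \<in> space M. \<epsilon> < D m n \<omega>} \<le> prob {\<omega> \<in> space M. \<epsilon> < \<bar>D m n \<omega>\<bar>}"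
      by (rule finite_measure_mono) auto
    also have "prob {\<omega> \<in> space M. \<epsilon> < - D m n \<omega>} \<le> prob {\<omega> \<in> space M. \<epsilon> < \<bar>D m n \<omega>\<bar>}"
      by (rule finite_measure_mono) auto
    finally show ?thesis by simp
  qed
  have "AE \<omega> in M. \<exists>m. \<forall>n\<ge>m. \<bar>D m n \<omega>\<bar> \<le> \<epsilon>" if \<epsilon>: "\<epsilon> > 0" for \<epsilon>
  proof -
    let ?N = "{\<omega> \<in> space M. \<forall>m. \<exists>n\<ge>m. \<epsilon> < \<bar>D m n \<omega>\<bar>}"
    have [measurable]: "?N \<in> events" by measurable
    have "prob ?N \<le> 0"
    proof (rule field_le_epsilon)
      fix \<eta> :: real assume \<eta>: "\<eta> > 0"
      \<comment> \<open>The quarter offsets the factor 4 of \<open>max\<close>, so every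
        \<open>E n\<close> with \<open>n \<ge> m\<close> has probability at most
        \<open>\<eta>\<close>. As the \<open>E n\<close> increase, the bound passes to their union,
        which contains \<open>?N\<close>.\<close>
      obtain m where m: "\<And>n. n \<ge> m \<Longrightarrow> prob {\<omega> \<in> space M. \<epsilon> < \<bar>D m n \<omega>\<bar>} \<le> \<eta> / 4"
        using Cauchy_in_probability_of_tight[OF ind sym tight \<epsilon>, of "\<eta> / 4"] \<eta>
        by (auto simp: D_def)
      define E where "E n = {\<omega> \<in> space M. \<exists>k\<in>{m..n}. \<epsilon> < \<bar>D m k \<omega>\<bar>}" for n
      have "(\<lambda>n. prob (E n)) \<longlonglongrightarrow> prob (\<Union>n. E n)"
        by (rule finite_Lim_measure_incseq) (auto simp: E_def incseq_def)
      moreover have "prob (E n) \<le> \<eta>" if "n \<ge> m" for n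
        unfolding E_def using max[of m n \<epsilon>] m[OF that] by linarith
      ultimately have "prob (\<Union>n. E n) \<le> \<eta>"
        by (intro LIMSEQ_le_const2) auto
      moreover have "prob ?N \<le> prob (\<Union>n. E n)"
      proof (rule finite_measure_mono)
        show "?N \<subseteq> (\<Union>n. E n)"
        proof safe
          fix \<omega> assume "\<omega> \<in> space M" "\<forall>m. \<exists>n\<ge>m. \<epsilon> < \<bar>D m n \<omega>\<bar>"
          then obtain n where "n \<ge> m" "\<epsilon> < \<bar>D m n \<omega>\<bar>" by blast
          with \<open>\<omega> \<in> space M\<close> show "\<omega> \<in> (\<Union>n. E n)"
            by (intro UN_I[of n]) (auto simp: E_def)
        qed
        show "(\<Union>n. E n) \<in> events" unfolding E_def by measurable
      qed
      ultimately show "prob ?N \<le> 0 + \<eta>" by simp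
    qed
    then have "prob ?N = 0" by (simp add: measure_le_0_iff)
    then have "AE \<omega> in M. \<omega> \<notin> ?N" by (simp add: prob_eq_0)
    then show ?thesis using AE_space by eventually_elim (auto simp: not_less)
  qed
  \<comment> \<open>Countably many thresholds suffice for the Cauchy property, so one null set
    serves them all.\<close>
  then have "AE \<omega> in M. \<forall>k. \<exists>m. \<forall>n\<ge>m. \<bar>D m n \<omega>\<bar> \<le> inverse (real (Suc k))"
    by (subst AE_all_countable) auto
  then show ?thesis
  proof eventually_elim
    case (elim \<omega>)
    have "Cauchy (\<lambda>n. \<Sum>i<n. X i \<omega>)"
    proof (rule metric_CauchyI)
      fix e :: real assume "e > 0"
      then obtain k where k: "inverse (real (Suc k)) < e / 2"
        using reals_Archimedean[of "e / 2"] by auto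
      from elim obtain m where m: "\<And>n. n \<ge> m \<Longrightarrow> \<bar>D m n \<omega>\<bar> \<le> inverse (real (Suc k))" by blast
      have "dist (\<Sum>i<p. X i \<omega>) (\<Sum>i<q. X i \<omega>) < e" if "p \<ge> m" "q \<ge> m" for p q
        using m[OF that(1)] m[OF that(2)] k that
        by (simp add: sum_lessThan_split[of m p] sum_lessThan_split[of m q] dist_real_def
            D_def[symmetric])
      then show "\<exists>M. \<forall>m\<ge>M. \<forall>n\<ge>M. dist (\<Sum>i<m. X i \<omega>) (\<Sum>i<n. X i \<omega>) < e" by blast
    qed
    then show ?case by (rule Cauchy_convergent)
  qed
qed

section \<open>The zero-one law for unboundedness from above\<close>

text \<open>Deleting the first \<open>k\<close> terms shifts the later partial sums by a finite
  amount, so unboundedness is a tail event.\<close>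

lemma prob_unbounded_partial_sums_0_1:
  fixes X :: "nat \<Rightarrow> 'a \<Rightarrow> real"
  assumes ind: "indep_vars (\<lambda>_. borel) X UNIV"
  defines "U \<equiv> {\<omega> \<in> space M. \<forall>r::nat. \<exists>n. real r < (\<Sum>i<n. X i \<omega>)}"
  shows "prob U = 0 \<or> prob U = 1"
proof (rule kolmogorov_0_1_law)
  define A where "A i = sigma_sets (space M) {X i -` B \<inter> space M | B. B \<in> sets borel}" for i
  show "sigma_algebra (space M) (A i)" for i
    unfolding A_def by (rule sigma_algebra_sigma_sets) auto
  show "indep_sets A UNIV"
    using ind unfolding indep_vars_def A_def by simp
  show "U \<in> tail_events A"
    unfolding tail_events_def
  proof
    fix k
    \<comment> \<open>The sigma-algebra generated by the terms from \<open>k\<close> on, packaged as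
      a measure space so that membership of \<open>U\<close> becomes a measurability
      question.\<close>
    define N where "N = sigma (space M) (\<Union> (A ` {k..}))"
    have A_Pow: "\<Union> (A ` {k..}) \<subseteq> Pow (space M)"
    proof -
      have "A i \<subseteq> Pow (space M)" for i
        unfolding A_def using sigma_sets_into_sp[of "{X i -` B \<inter> space M | B. B \<in> sets borel}" "space M"] by blast
      then show ?thesis by blast
    qed
    have N: "space N = space M" "sets N = sigma_sets (space M) (\<Union> (A ` {k..}))"
      using A_Pow by (auto simp: N_def space_measure_of_conv)
    have X [measurable]: "X i \<in> borel_measurable N" if "i \<ge> k" for i
    proof (rule measurableI)
      fix B :: "real set" assume "B \<in> sets borel"
      then have "X i -` B \<inter> space M \<in> A i" unfolding A_def by auto
      with that show "X i -` B \<inter> space N \<in> sets N" unfolding N by auto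
    qed auto
    have D [measurable]: "(\<lambda>\<omega>. \<Sum>i=k..<n. X i \<omega>) \<in> borel_measurable N" for n
      by (intro borel_measurable_sum X) auto
    have "(\<forall>r::nat. \<exists>n. real r < (\<Sum>i<n. X i \<omega>)) \<longleftrightarrow> (\<forall>r::nat. \<exists>n\<ge>k. real r < (\<Sum>i=k..<n. X i \<omega>))" for \<omega>
    proof safe
      fix r :: nat
      assume *: "\<forall>r::nat. \<exists>n. real r < (\<Sum>i<n. X i \<omega>)"
      \<comment> \<open>The added absolute values do two jobs: no partial sum with fewer than
        \<open>k\<close> terms can exceed \<open>b\<close>, so \<open>n \<ge> k\<close>; and
        removing the first \<open>k\<close> terms from a sum above \<open>b\<close> still leaves
        more than \<open>r\<close>.\<close>
      define b where "b = real r + (\<Sum>i<k. \<bar>X i \<omega>\<bar>)"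
      obtain n where n: "b < (\<Sum>i<n. X i \<omega>)"
        using * real_arch_simple[of b] by (meson le_less_trans)
      have "n \<ge> k"
      proof (rule ccontr)
        assume "\<not> n \<ge> k"
        then have "(\<Sum>i<n. X i \<omega>) \<le> (\<Sum>i<k. \<bar>X i \<omega>\<bar>)"
          by (intro order_trans[OF sum_mono sum_mono2]) auto
        with n show False by (simp add: b_def)
      qed
      moreover have "(\<Sum>i<k. X i \<omega>) \<le> (\<Sum>i<k. \<bar>X i \<omega>\<bar>)" by (rule sum_mono) auto
      ultimately show "\<exists>n\<ge>k. real r < (\<Sum>i=k..<n. X i \<omega>)"
        using n sum_lessThan_split[of k n "\<lambda>i. X i \<omega>"] by (auto simp: b_def)
    next
      fix r :: nat
      assume *: "\<forall>r::nat. \<exists>n\<ge>k. real r < (\<Sum>i=k..<n. X i \<omega>)"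
      obtain n where n: "n \<ge> k" "real r - (\<Sum>i<k. X i \<omega>) < (\<Sum>i=k..<n. X i \<omega>)"
        using * real_arch_simple[of "real r - (\<Sum>i<k. X i \<omega>)"] by (meson le_less_trans)
      then show "\<exists>n. real r < (\<Sum>i<n. X i \<omega>)"
        using sum_lessThan_split[of k n "\<lambda>i. X i \<omega>"] by (intro exI[of _ n]) simp
    qed
    then have "U = {\<omega> \<in> space N. \<forall>r::nat. \<exists>n\<ge>k. real r < (\<Sum>i=k..<n. X i \<omega>)}"
      by (simp add: U_def N)
    also have "\<dots> \<in> sets N" by measurable
    finally show "U \<in> sigma_sets (space M) (\<Union> (A ` {k..}))" by (simp add: N)
  qed
qed

section \<open>The infinite upper limit, and the lower limit by reflection\<close>

text \<open>If unboundedness had probability 0, the sums would be tight and hence converge almost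
  surely, against \<open>div\<close>; the zero-one law leaves only probability 1.\<close>

lemma AE_limsup_partial_sums_infinite:
  fixes X :: "nat \<Rightarrow> 'a \<Rightarrow> real"
  assumes ind: "indep_vars (\<lambda>_. borel) X UNIV"
    and sym: "\<And>i. symmetric_rv M (X i)"
    and div: "AE \<omega> in M. \<not> convergent (\<lambda>n. \<Sum>i<n. X i \<omega>)"
  shows "AE \<omega> in M. limsup (\<lambda>n. ereal (\<Sum>i<n. X i \<omega>)) = \<infinity>"
proof -
  note [measurable] = indep_vars_sequence_measurable[OF ind]
  define E where "E r = {\<omega> \<in> space M. \<exists>n. real r < (\<Sum>i<n. X i \<omega>)}" for r :: nat
  define U where "U = {\<omega> \<in> space M. \<forall>r::nat. \<exists>n. real r < (\<Sum>i<n. X i \<omega>)}"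
  have [measurable]: "U \<in> events" "E r \<in> events" for r unfolding U_def E_def by measurable
  have "prob U \<noteq> 0"
  proof
    assume "prob U = 0"
    moreover have "(\<Inter>r. E r) = U" by (auto simp: E_def U_def)
    \<comment> \<open>The events \<open>E r\<close> decrease to \<open>U\<close>, so continuity from
      above gives a tail bound uniform in \<open>n\<close>.\<close>
    moreover have "(\<lambda>r. prob (E r)) \<longlonglongrightarrow> prob (\<Inter>r. E r)"
      by (rule finite_Lim_measure_decseq)
         (auto simp: E_def decseq_def intro: le_less_trans[OF of_nat_mono])
    ultimately have lim: "(\<lambda>r. prob (E r)) \<longlonglongrightarrow> 0" by simp
    have "\<exists>A. \<forall>n. prob {\<omega> \<in> space M. A < (\<Sum>i<n. X i \<omega>)} \<le> e" if e: "e > 0" for e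
    proof -
      obtain r where "prob (E r) < e"
        using order_tendstoD(2)[OF lim e] by (auto simp: eventually_sequentially)
      moreover have "prob {\<omega> \<in> space M. real r < (\<Sum>i<n. X i \<omega>)} \<le> prob (E r)" for n
        by (rule finite_measure_mono) (auto simp: E_def)
      ultimately show ?thesis
        by (intro exI[of _ "real r"] allI) (blast intro: less_imp_le le_less_trans)
    qed
    then have "AE \<omega> in M. convergent (\<lambda>n. \<Sum>i<n. X i \<omega>)"
      by (intro AE_convergent_of_tight ind sym)
    with div have "AE \<omega> in M. False" by eventually_elim simp
    then show False by simp
  qed
  then have "prob U = 1"
    using prob_unbounded_partial_sums_0_1[OF ind] by (simp add: U_def)
  then have "AE \<omega> in M. \<omega> \<in> U" by (simp add: AE_in_set_eq_1)
  then show ?thesis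
  proof eventually_elim
    case (elim \<omega>)
    define T where "T n = (\<Sum>i<n. X i \<omega>)" for n
    have "limsup (\<lambda>n. ereal (T n)) = \<infinity>"
    proof (rule ccontr)
      assume "limsup (\<lambda>n. ereal (T n)) \<noteq> \<infinity>"
      then obtain c :: nat where "limsup (\<lambda>n. ereal (T n)) < ereal (real c)"
        using less_PInf_Ex_of_nat by blast
      then obtain n0 where n0: "\<forall>n\<ge>n0. T n < real c"
        by (auto dest!: Limsup_lessD simp: eventually_sequentially)
      \<comment> \<open>\<open>r\<close> dominates both the eventual bound \<open>c\<close> and
        every partial sum before \<open>n0\<close>, so a partial sum above \<open>r\<close> is
        impossible at any index.\<close>
      obtain r :: nat where r: "real c + (\<Sum>n<n0. \<bar>T n\<bar>) \<le> real r"
        using real_arch_simple by blast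
      from elim obtain n where n: "real r < T n" by (auto simp: U_def T_def)
      show False
      proof (cases "n \<ge> n0")
        case True
        have "0 \<le> (\<Sum>n<n0. \<bar>T n\<bar>)" by (rule sum_nonneg) auto
        with n0 True n r show False by fastforce
      next
        case False
        then have "\<bar>T n\<bar> \<le> (\<Sum>n<n0. \<bar>T n\<bar>)" by (intro member_le_sum) auto
        with n r show False by linarith
      qed
    qed
    then show ?case by (simp add: T_def)
  qed
qed

end

theorem proposition1p16:
  fixes M :: "'a measure" and S :: "nat \<Rightarrow> 'a \<Rightarrow> real"
  assumes "prob_space M"
    and "prob_space.indep_vars M (\<lambda>_. borel) S {1..}"
    and "\<And>j. j \<ge> 1 \<Longrightarrow> symmetric_rv M (S j)"
    and "AE \<omega> in M. \<not> convergent (\<lambda>n. \<Sum>j=1..n. S j \<omega>)"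
  shows "AE \<omega> in M. limsup (\<lambda>n. ereal (\<Sum>j=1..n. S j \<omega>)) = \<infinity> \<and>
                    liminf (\<lambda>n. ereal (\<Sum>j=1..n. S j \<omega>)) = - \<infinity>"
proof -
  interpret prob_space M by fact
  \<comment> \<open>The theorem numbers terms from 1, the lemmas from 0; the shift aligns the first
    \<open>n\<close> terms of both.\<close>
  define X where "X i = S (Suc i)" for i
  have sum_X: "(\<Sum>j=1..n. S j \<omega>) = (\<Sum>i<n. X i \<omega>)" for n \<omega>
    by (simp add: X_def sum.atLeast1_atMost_eq)
  \<comment> \<open>Independence is reindexed along \<open>Suc\<close> by grouping into the disjoint
    singleton blocks \<open>{Suc j}\<close> and then evaluating each block at its only
    index.\<close>
  have "indep_vars (\<lambda>j. PiM {Suc j} (\<lambda>_. borel)) (\<lambda>j \<omega>. restrict (\<lambda>i. S i \<omega>) {Suc j}) UNIV"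
    by (rule indep_vars_restrict[OF assms(2)]) (auto simp: disjoint_family_on_def)
  then have "indep_vars (\<lambda>_. borel) (\<lambda>j \<omega>. (\<lambda>f. f (Suc j)) (restrict (\<lambda>i. S i \<omega>) {Suc j})) UNIV"
    by (rule indep_vars_compose2) (auto intro: measurable_component_singleton)
  then have ind: "indep_vars (\<lambda>_. borel) X UNIV" by (simp add: X_def[abs_def])
  have ind': "indep_vars (\<lambda>_. borel) (\<lambda>i \<omega>. - X i \<omega>) UNIV"
    by (rule indep_vars_compose2[OF ind]) measurable
  have sym: "symmetric_rv M (X i)" for i using assms(3) by (simp add: X_def)
  have div: "AE \<omega> in M. \<not> convergent (\<lambda>n. \<Sum>i<n. X i \<omega>)" using assms(4) unfolding sum_X .
  then have div': "AE \<omega> in M. \<not> convergent (\<lambda>n. \<Sum>i<n. - X i \<omega>)"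
    by (simp add: sum_negf convergent_minus_iff[symmetric])
  \<comment> \<open>The negated terms satisfy the same hypotheses, and the upper limit of the
    negated sums is minus the lower limit of the sums.\<close>
  have "AE \<omega> in M. limsup (\<lambda>n. - ereal (\<Sum>i<n. X i \<omega>)) = \<infinity>"
    using AE_limsup_partial_sums_infinite[OF ind' symmetric_rv_uminus[OF sym] div']
    by (simp add: sum_negf)
  with AE_limsup_partial_sums_infinite[OF ind sym div] show ?thesis
    unfolding sum_X by eventually_elim (simp add: ereal_Limsup_uminus ereal_uminus_eq_reorder del: uminus_ereal.simps)
qed

end
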